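(* Let $X\subseteq\mathbb C$ be a set with a marked point $a\in X$ (with the usual metric $|x-y|$). If $X$ is starlike with the center $a$, then for each tangent space $\Omega_{a,\tilde r}^X$ to $X$ at $a$ there is an isometry $$\psi:\Omega_{a,\tilde r}^X\to Con_a(X),\qquad \psi(\alpha)=a,$$ where $\alpha=p(\tilde a)$, and, moreover, every pretangent space $\Omega_{a,\tilde r}^X$ to $X$ at $a$ lies in some tangent space $\Omega_{a,\tilde r'}^X$.
   Context: Pretangent and tangent spaces. Let $(X,d)$ be a metric space with a marked point $a\in X$. A normalizing sequence is a sequence $\tilde r=\{r_n\}_{n\in\mathbb N}$ of positive reals with $r_n\to0$. $\tilde X$ is the set of all sequences of points of $X$. Sequences $\tilde x=\{x_n\},\tilde y=\{y_n\}\in\tilde X$ are mutually stable w.r.t. $\tilde r$ if the finite limit $\tilde d_{\tilde r}(\tilde x,\tilde y)=\tilde d(\tilde x,\tilde y):=\lim_{n\to\infty} d(x_n,y_n)/r_n$ exists. A family $\tilde F\subseteq\tilde X$ is self-stable (w.r.t. $\tilde r$) if every two of its elements are mutually stable; it is maximal self-stable if it is self-stable and every $\tilde z\in\tilde X$ either belongs to $\tilde F$ or is not mutually stable with some $\tilde x\in\tilde F$. Write $\tilde a=(a,a,\dots)$. $\tilde X_{a,\tilde r}$ denotes a maximal self-stable (w.r.t. $\tilde r$) family containing $\tilde a$; $\tilde d$ is a pseudometric on it. The metric identification of $(\tilde X_{a,\tilde r},\tilde d)$ (the quotient by $\tilde d(\tilde x,\tilde y)=0$ with the induced metric) is denoted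 $\Omega_{a,\tilde r}=\Omega^X_{a,\tilde r}$ and called a pretangent space to $X$ at $a$ w.r.t. $\tilde r$ (it depends on the choice of $\tilde X_{a,\tilde r}$); $p:\tilde X_{a,\tilde r}\to\Omega_{a,\tilde r}$ is the quotient map. An isometry is a distance-preserving surjection. For a subsequence $\tilde r'=\{r_{n_k}\}_k$ of $\tilde r$ ($n_k$ strictly increasing) and $\tilde x\in\tilde X$ put $\tilde x'=\{x_{n_k}\}_k$. There is a maximal self-stable (w.r.t. $\tilde r'$) family $\tilde X_{a,\tilde r'}\supseteq\{\tilde x':\tilde x\in\tilde X_{a,\tilde r}\}$, and $\tilde x\mapsto\tilde x'$ induces a distance-preserving map $em':\Omega_{a,\tilde r}\to\Omega_{a,\tilde r'}$, where $\Omega_{a,\tilde r'}$ is the metric identification of $\tilde X_{a,\tilde r'}$. The pretangent space $\Omega_{a,\tilde r}$ is tangent if $em'$ is an isometry for every subsequence $\tilde r'$ (this does not depend on the choice of $\tilde X_{a,\tilde r'}$). The pretangent space $\Omega_{a,\tilde r}$ (with corresponding family $\tilde X_{a,\tilde r}$) lies in a tangent space $\Omega_{a,\tilde r'}$ if for some subsequence $\tilde r'$ of $\tilde r$ there is a maximal self-stable (w.r.t. $\tilde r'$) family $\tilde X_{a,\tilde r'}\supseteq\{\tilde x':\tilde x\in\tilde X_{a,\tilde r}\}$ whose metric identification $\Omega_{a,\tilde r'}$ is tangent. Cones and starlike sets. A set $A\subseteq\mathbb C$ is starlike with center $a$ if $[a,b]=\{a+t(b-a):t\in[0,1]\}\subseteq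 A$ for all $b\in A$. $A$ is a cone with vertex $a$ if the ray $l_a(b)=\{a+t(b-a):t\in[0,\infty)\}$ lies in $A$ for every $b\in A$. $Con_a(X)$ is the intersection of all closed cones $A\supseteq X$ with vertex $a$. *)

theory Defs
  imports "HOL-Analysis.Analysis"
begin

section \<open>Pretangent and tangent spaces\<close>

definition normalizing :: "(nat \<Rightarrow> real) \<Rightarrow> bool" where
  "normalizing r \<longleftrightarrow> (\<forall>n. 0 < r n) \<and> r \<longlonglongrightarrow> 0"

definition mutually_stable ::
    "(nat \<Rightarrow> real) \<Rightarrow> (nat \<Rightarrow> 'a::metric_space) \<Rightarrow> (nat \<Rightarrow> 'a) \<Rightarrow> bool" where
  "mutually_stable r x y \<longleftrightarrow> convergent (\<lambda>n. dist (x n) (y n) / r n)"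

text \<open>Meaningful only for mutually stable sequences.\<close>

definition seq_dist ::
    "(nat \<Rightarrow> real) \<Rightarrow> (nat \<Rightarrow> 'a::metric_space) \<Rightarrow> (nat \<Rightarrow> 'a) \<Rightarrow> real" where
  "seq_dist r x y = lim (\<lambda>n. dist (x n) (y n) / r n)"

definition self_stable :: "(nat \<Rightarrow> real) \<Rightarrow> (nat \<Rightarrow> 'a::metric_space) set \<Rightarrow> bool" where
  "self_stable r F \<longleftrightarrow> (\<forall>x\<in>F. \<forall>y\<in>F. mutually_stable r x y)"

definition maximal_self_stable ::
    "'a::metric_space set \<Rightarrow> (nat \<Rightarrow> real) \<Rightarrow> (nat \<Rightarrow> 'a) set \<Rightarrow> bool" where
  "maximal_self_stable X r F \<longleftrightarrow>
     F \<subseteq> (UNIV \<rightarrow> X) \<and> self_stable r F \<and>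
     (\<forall>z \<in> UNIV \<rightarrow> X. z \<in> F \<or> (\<exists>x\<in>F. \<not> mutually_stable r z x))"

text \<open>A pretangent space depends on the chosen family, so it is represented by the pair of
  the normalizing sequence \<open>r\<close> and the family \<open>F\<close>.\<close>

definition pretangent_family ::
    "'a::metric_space set \<Rightarrow> 'a \<Rightarrow> (nat \<Rightarrow> real) \<Rightarrow> (nat \<Rightarrow> 'a) set \<Rightarrow> bool" where
  "pretangent_family X a r F \<longleftrightarrow>
     normalizing r \<and> maximal_self_stable X r F \<and> (\<lambda>n. a) \<in> F"

definition zero_dist_rel ::
    "(nat \<Rightarrow> real) \<Rightarrow> (nat \<Rightarrow> 'a::metric_space) set \<Rightarrow> ((nat \<Rightarrow> 'a) \<times> (nat \<Rightarrow> 'a)) set" where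
  "zero_dist_rel r F = {(x, y). x \<in> F \<and> y \<in> F \<and> seq_dist r x y = 0}"

definition pretangent_space ::
    "(nat \<Rightarrow> real) \<Rightarrow> (nat \<Rightarrow> 'a::metric_space) set \<Rightarrow> (nat \<Rightarrow> 'a) set set" where
  "pretangent_space r F = F // zero_dist_rel r F"

definition pretangent_proj ::
    "(nat \<Rightarrow> real) \<Rightarrow> (nat \<Rightarrow> 'a::metric_space) set \<Rightarrow> (nat \<Rightarrow> 'a) \<Rightarrow> (nat \<Rightarrow> 'a) set" where
  "pretangent_proj r F x = zero_dist_rel r F `` {x}"

text \<open>The set below is a singleton when \<open>A\<close> and \<open>B\<close> are points of a pretangent space; see
  \<open>pretangent_dist_proj\<close>.\<close>

definition pretangent_dist ::
    "(nat \<Rightarrow> real) \<Rightarrow> (nat \<Rightarrow> 'a::metric_space) set \<Rightarrow> (nat \<Rightarrow> 'a) set \<Rightarrow> real" where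
  "pretangent_dist r A B = the_elem ((\<lambda>(x, y). seq_dist r x y) ` (A \<times> B))"

definition isometry_between ::
    "'p set \<Rightarrow> ('p \<Rightarrow> 'p \<Rightarrow> real) \<Rightarrow> 'q set \<Rightarrow> ('q \<Rightarrow> 'q \<Rightarrow> real) \<Rightarrow> ('p \<Rightarrow> 'q) \<Rightarrow> bool" where
  "isometry_between M d M' d' f \<longleftrightarrow>
     f ` M = M' \<and> (\<forall>x\<in>M. \<forall>y\<in>M. d' (f x) (f y) = d x y)"

text \<open>A subsequence is given by a strictly increasing index map \<open>s\<close>; here \<open>F'\<close> is a family
  containing \<open>x \<circ> s\<close> for all \<open>x \<in> F\<close>. The set below is a singleton when \<open>A\<close> is a point of the
  pretangent space; see \<open>em_proj\<close>.\<close>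

definition em ::
    "(nat \<Rightarrow> real) \<Rightarrow> (nat \<Rightarrow> nat) \<Rightarrow> (nat \<Rightarrow> 'a::metric_space) set \<Rightarrow>
       (nat \<Rightarrow> 'a) set \<Rightarrow> (nat \<Rightarrow> 'a) set" where
  "em r s F' A = the_elem ((\<lambda>x. pretangent_proj (r \<circ> s) F' (x \<circ> s)) ` A)"

definition tangent ::
    "'a::metric_space set \<Rightarrow> 'a \<Rightarrow> (nat \<Rightarrow> real) \<Rightarrow> (nat \<Rightarrow> 'a) set \<Rightarrow> bool" where
  "tangent X a r F \<longleftrightarrow>
     pretangent_family X a r F \<and>
     (\<forall>s F'. strict_mono s \<longrightarrow> maximal_self_stable X (r \<circ> s) F' \<longrightarrow>
        (\<lambda>x. x \<circ> s) ` F \<subseteq> F' \<longrightarrow>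
        isometry_between (pretangent_space r F) (pretangent_dist r)
          (pretangent_space (r \<circ> s) F') (pretangent_dist (r \<circ> s)) (em r s F'))"

definition lies_in_tangent ::
    "'a::metric_space set \<Rightarrow> 'a \<Rightarrow> (nat \<Rightarrow> real) \<Rightarrow> (nat \<Rightarrow> 'a) set \<Rightarrow> bool" where
  "lies_in_tangent X a r F \<longleftrightarrow>
     (\<exists>s F'. strict_mono s \<and> maximal_self_stable X (r \<circ> s) F' \<and>
        (\<lambda>x. x \<circ> s) ` F \<subseteq> F' \<and> tangent X a (r \<circ> s) F')"


section \<open>Starlike sets and cones with a given center or vertex\<close>

text \<open>The library's \<open>starlike\<close> does not fix the center, and its \<open>cone\<close> has vertex 0.\<close>

definition starlike_at :: "complex \<Rightarrow> complex set \<Rightarrow> bool" where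
  "starlike_at a A \<longleftrightarrow> (\<forall>b\<in>A. closed_segment a b \<subseteq> A)"

definition cone_at :: "complex \<Rightarrow> complex set \<Rightarrow> bool" where
  "cone_at a A \<longleftrightarrow> (\<forall>b\<in>A. \<forall>t\<ge>0. a + of_real t * (b - a) \<in> A)"

definition Con :: "complex \<Rightarrow> complex set \<Rightarrow> complex set" where
  "Con a X = \<Inter>{A. closed A \<and> cone_at a A \<and> X \<subseteq> A}"


section \<open>Well-definedness\<close>

lemma seq_dist_tendsto:
  "mutually_stable r x y \<Longrightarrow> (\<lambda>n. dist (x n) (y n) / r n) \<longlonglongrightarrow> seq_dist r x y"
  unfolding mutually_stable_def seq_dist_def by (simp add: convergent_LIMSEQ_iff)

lemma seq_dist_commute: "seq_dist r x y = seq_dist r y x"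
  unfolding seq_dist_def by (simp add: dist_commute)

lemma seq_dist_self [simp]: "seq_dist r x x = 0"
  unfolding seq_dist_def by simp

lemma seq_dist_triangle:
  assumes "\<And>n. 0 < r n" "self_stable r F" "x \<in> F" "y \<in> F" "z \<in> F"
  shows "seq_dist r x z \<le> seq_dist r x y + seq_dist r y z"
proof -
  have "mutually_stable r u v" if "u \<in> F" "v \<in> F" for u v
    using assms(2) that unfolding self_stable_def by blast
  then have *: "(\<lambda>n. dist (u n) (v n) / r n) \<longlonglongrightarrow> seq_dist r u v" if "u \<in> F" "v \<in> F" for u v
    using seq_dist_tendsto that by blast
  show ?thesis
  proof (rule LIMSEQ_le [OF *[OF assms(3,5)]
        tendsto_add[OF *[OF assms(3,4)] *[OF assms(4,5)]]], intro exI allI impI)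
    fix n show "dist (x n) (z n) / r n \<le> dist (x n) (y n) / r n + dist (y n) (z n) / r n"
      using assms(1)[of n] dist_triangle[of "x n" "z n" "y n"]
      by (simp add: add_divide_distrib [symmetric] divide_right_mono)
  qed
qed

lemma seq_dist_nonneg:
  assumes "\<And>n. 0 < r n" "self_stable r F" "x \<in> F" "y \<in> F"
  shows "0 \<le> seq_dist r x y"
  using seq_dist_triangle[OF assms(1,2,3,4,3)] by (simp add: seq_dist_commute)

lemma equiv_zero_dist_rel:
  assumes "\<And>n. 0 < r n" "self_stable r F"
  shows "equiv F (zero_dist_rel r F)"
proof (rule equivI)
  show "trans (zero_dist_rel r F)"
  proof (rule transI)
    fix x y z
    assume "(x, y) \<in> zero_dist_rel r F" "(y, z) \<in> zero_dist_rel r F"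
    then show "(x, z) \<in> zero_dist_rel r F"
      using seq_dist_triangle[OF assms, of x y z] seq_dist_nonneg[OF assms, of x z]
      by (auto simp: zero_dist_rel_def)
  qed
qed (auto simp: zero_dist_rel_def refl_on_def sym_def seq_dist_commute)

lemma the_elem_image:
  assumes "a \<in> A" "\<And>b. b \<in> A \<Longrightarrow> f b = c"
  shows "the_elem (f ` A) = c"
proof -
  have "f ` A = {c}"
    using assms by blast
  then show ?thesis by simp
qed

lemma pretangent_dist_proj:
  assumes "\<And>n. 0 < r n" "self_stable r F" "x \<in> F" "y \<in> F"
  shows "pretangent_dist r (pretangent_proj r F x) (pretangent_proj r F y) = seq_dist r x y"
  unfolding pretangent_dist_def
proof (rule the_elem_image)
  show "(x, y) \<in> pretangent_proj r F x \<times> pretangent_proj r F y"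
    using assms(3,4) by (simp add: pretangent_proj_def zero_dist_rel_def)
  fix w assume "w \<in> pretangent_proj r F x \<times> pretangent_proj r F y"
  then obtain u v where w: "w = (u, v)" and uv: "u \<in> F" "v \<in> F"
    and 0: "seq_dist r x u = 0" "seq_dist r y v = 0"
    by (auto simp: pretangent_proj_def zero_dist_rel_def)
  have "seq_dist r u v = seq_dist r x y"
    using seq_dist_triangle[OF assms(1,2) uv(1) assms(3) uv(2)]
      seq_dist_triangle[OF assms(1,2) assms(3,4) uv(2)]
      seq_dist_triangle[OF assms(1,2) assms(3) uv(1) assms(4)]
      seq_dist_triangle[OF assms(1,2) uv(1,2) assms(4)]
      0 seq_dist_commute[of r u x] seq_dist_commute[of r v y]
    by linarith
  then show "(case w of (u, v) \<Rightarrow> seq_dist r u v) = seq_dist r x y"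
    by (simp add: w)
qed

lemma em_proj:
  assumes "\<And>n. 0 < r n" "self_stable r F" "strict_mono s" "self_stable (r \<circ> s) F'"
    "(\<lambda>x. x \<circ> s) ` F \<subseteq> F'" "x \<in> F"
  shows "em r s F' (pretangent_proj r F x) = pretangent_proj (r \<circ> s) F' (x \<circ> s)"
proof -
  have eq: "equiv F' (zero_dist_rel (r \<circ> s) F')"
    using equiv_zero_dist_rel[of "r \<circ> s" F'] assms(1,4) by simp
  have "pretangent_proj (r \<circ> s) F' (u \<circ> s) = pretangent_proj (r \<circ> s) F' (x \<circ> s)"
    if u: "u \<in> pretangent_proj r F x" for u
  proof -
    have uF: "u \<in> F" and 0: "seq_dist r x u = 0"
      using u by (auto simp: pretangent_proj_def zero_dist_rel_def)
    have "(\<lambda>n. dist (x n) (u n) / r n) \<longlonglongrightarrow> 0"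
      using seq_dist_tendsto[of r x u] 0 uF assms(2,6) by (auto simp: self_stable_def)
    from LIMSEQ_subseq_LIMSEQ[OF this assms(3)]
    have "seq_dist (r \<circ> s) (x \<circ> s) (u \<circ> s) = 0"
      by (auto simp: seq_dist_def o_def intro: limI)
    then have "(x \<circ> s, u \<circ> s) \<in> zero_dist_rel (r \<circ> s) F'"
      using uF assms(5,6) by (auto simp: zero_dist_rel_def)
    then show ?thesis
      unfolding pretangent_proj_def by (rule equiv_class_eq[OF eq, symmetric])
  qed
  moreover have "x \<in> pretangent_proj r F x"
    using assms(6) by (simp add: pretangent_proj_def zero_dist_rel_def)
  ultimately show ?thesis
    unfolding em_def by (intro the_elem_image)
qed

text \<open>Applied to the family of all \<open>x \<circ> s\<close> with \<open>x \<in> F\<close>, this yields the families \<open>F'\<close>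
  quantified over in \<open>tangent\<close>.\<close>

lemma maximal_self_stable_exists:
  assumes "F \<subseteq> UNIV \<rightarrow> X" "self_stable r F"
  shows "\<exists>G. maximal_self_stable X r G \<and> F \<subseteq> G"
proof -
  let ?C = "{G. F \<subseteq> G \<and> G \<subseteq> UNIV \<rightarrow> X \<and> self_stable r G}"
  have "\<exists>M\<in>?C. \<forall>G\<in>?C. M \<subseteq> G \<longrightarrow> G = M"
  proof (rule subset_Zorn_nonempty)
    show "?C \<noteq> {}" using assms by blast
    fix K assume K: "K \<noteq> {}" "subset.chain ?C K"
    have "mutually_stable r x y" if "x \<in> \<Union>K" "y \<in> \<Union>K" for x y
    proof -
      from that obtain G where G: "G \<in> K" "x \<in> G" by (elim UnionE)
      from that obtain H where H: "H \<in> K" "y \<in> H" by (elim UnionE)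
      have "G \<subseteq> H \<or> H \<subseteq> G" "self_stable r G" "self_stable r H"
        using K G(1) H(1) by (auto simp: subset_chain_def)
      then show ?thesis using G(2) H(2) unfolding self_stable_def by blast
    qed
    then have "self_stable r (\<Union>K)" unfolding self_stable_def by blast
    moreover have sub: "K \<subseteq> ?C" using K(2) by (simp add: subset_chain_def)
    then have "\<Union>K \<subseteq> UNIV \<rightarrow> X" by (intro Union_least) auto
    moreover obtain G where "G \<in> K" using K(1) by blast
    with sub have "F \<subseteq> \<Union>K" by blast
    ultimately show "\<Union>K \<in> ?C" by simp
  qed
  then obtain M where M: "M \<in> ?C" and max: "\<And>G. G \<in> ?C \<Longrightarrow> M \<subseteq> G \<Longrightarrow> G = M"
    by (elim bexE) simp
  have "z \<in> M \<or> (\<exists>x\<in>M. \<not> mutually_stable r z x)" if z: "z \<in> UNIV \<rightarrow> X" for z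
  proof (rule ccontr)
    assume *: "\<not> ?thesis"
    have zz: "mutually_stable r z z" by (simp add: mutually_stable_def convergent_const)
    have zM: "mutually_stable r z x" if "x \<in> M" for x using * that by blast
    then have Mz: "mutually_stable r x z" if "x \<in> M" for x
      using that by (simp add: mutually_stable_def dist_commute)
    have "self_stable r M" using M by blast
    then have "self_stable r (insert z M)"
      using zz zM Mz by (simp add: self_stable_def)
    moreover have "F \<subseteq> insert z M" "insert z M \<subseteq> UNIV \<rightarrow> X"
      using M z by (simp_all add: subset_insertI2)
    ultimately have "insert z M = M" by (intro max) auto
    with * show False by blast
  qed
  with M show ?thesis unfolding maximal_self_stable_def by blast
qed

end

theory Submission
  imports Defs
begin

text \<open>Distances divided by \<open>r n\<close> are ordinary distances after the homothety with center \<open>a\<close> and ratio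
  \<open>1 / r n\<close> (\<open>blowup\<close>), so a self-stable family is a family of planar sequences whose mutual
  distances converge. The sequences need not converge themselves, since the configuration may
  rotate or be reflected as \<open>n\<close> varies. Two facts control this.

  First, for starlike \<open>X\<close> the limits of convergent blow-ups of sequences in \<open>X\<close> fill exactly
  \<open>Con a X\<close>: they lie in this closed cone (\<open>blowup_limit_in_Con\<close>), and each point of a ray
  through \<open>X\<close> belongs to the blown-up set for all large \<open>n\<close>, because shrinking towards \<open>a\<close>
  stays in \<open>X\<close> (\<open>Con_point_is_blowup_limit\<close>). A sequence \<open>z\<close> that is stable with all the sequences
  of convergent blow-up then has a convergent blow-up as well: a cluster point \<open>c\<close> of its blow-up
  lies in \<open>Con a X\<close>, so the distance from the blow-up to \<open>c\<close> converges, and the limit is 0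
  along a subsequence (\<open>blowup_convergent_if_stable_with_Con\<close>). Hence the family of all sequences
  with convergent blow-up is maximal self-stable, and since the argument survives the passage
  to subsequences, it gives a tangent space (\<open>tangent_convergent_family\<close>), isometric to
  \<open>Con a X\<close> by taking limits.

  Second, every pretangent family has a common subsequence along which all its blow-ups converge
  (\<open>common_convergent_subsequence\<close>): a limit point other than \<open>a\<close> pins down the rotation, and
  a limit point off the line through these two, if there is one, pins down the reflection, because
  a point of the plane is determined by its distances to three points that are not collinear. Along that subsequence the family is contained
  in the family of the first part; this is the second claim. If the given space is moreover tangent,
  its embedding into the tangent space of the first part is onto, and composing it with the limit
  map gives the isometry onto \<open>Con a X\<close>.\<close>

section \<open>Blow-ups\<close>

definition blowup :: "(nat \<Rightarrow> real) \<Rightarrow> complex \<Rightarrow> (nat \<Rightarrow> complex) \<Rightarrow> nat \<Rightarrow> complex" where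
  "blowup r a x n = a + (x n - a) /\<^sub>R r n"

definition convergent_family ::
    "complex set \<Rightarrow> complex \<Rightarrow> (nat \<Rightarrow> real) \<Rightarrow> (nat \<Rightarrow> complex) set" where
  "convergent_family X a r = {x \<in> UNIV \<rightarrow> X. convergent (blowup r a x)}"

lemma blowup_const [simp]: "blowup r a (\<lambda>n. a) = (\<lambda>n. a)"
  by (simp add: blowup_def fun_eq_iff)

lemma blowup_subseq: "blowup (r \<circ> s) a (x \<circ> s) = blowup r a x \<circ> s"
  by (simp add: blowup_def fun_eq_iff)

lemma dist_blowup:
  assumes "0 < r n"
  shows "dist (blowup r a x n) (blowup r a y n) = dist (x n) (y n) / r n"
proof -
  have "blowup r a x n - blowup r a y n = (x n - y n) /\<^sub>R r n"
    by (simp add: blowup_def algebra_simps)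
  then show ?thesis
    using assms by (simp add: dist_norm divide_inverse mult.commute)
qed

lemma mutually_stable_iff_blowup:
  assumes "\<And>n. 0 < r n"
  shows "mutually_stable r x y \<longleftrightarrow> convergent (\<lambda>n. dist (blowup r a x n) (blowup r a y n))"
  using assms by (simp add: mutually_stable_def dist_blowup)

lemma seq_dist_eq_dist_limits:
  assumes "\<And>n. 0 < r n" "blowup r a x \<longlonglongrightarrow> b" "blowup r a y \<longlonglongrightarrow> c"
  shows "mutually_stable r x y" "seq_dist r x y = dist b c"
proof -
  have *: "(\<lambda>n. dist (x n) (y n) / r n) \<longlonglongrightarrow> dist b c"
    using tendsto_dist[OF assms(2,3)] assms(1) by (simp add: dist_blowup)
  show "mutually_stable r x y"
    using * by (auto simp: mutually_stable_def convergent_def)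
  show "seq_dist r x y = dist b c"
    unfolding seq_dist_def using * by (rule limI)
qed

lemma seq_dist_subseq:
  assumes "mutually_stable r x y" "strict_mono s"
  shows "seq_dist (r \<circ> s) (x \<circ> s) (y \<circ> s) = seq_dist r x y"
proof -
  have "(\<lambda>n. dist ((x \<circ> s) n) ((y \<circ> s) n) / (r \<circ> s) n) \<longlonglongrightarrow> seq_dist r x y"
    using LIMSEQ_subseq_LIMSEQ[OF seq_dist_tendsto[OF assms(1)] assms(2)] by (simp add: o_def)
  then show ?thesis
    by (subst seq_dist_def) (rule limI)
qed

lemma normalizing_subseq: "normalizing r \<Longrightarrow> strict_mono s \<Longrightarrow> normalizing (r \<circ> s)"
  using LIMSEQ_subseq_LIMSEQ[of r 0 s] by (simp add: normalizing_def)

section \<open>Sequences with convergent distances\<close>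

lemma bounded_if_convergent_dist:
  fixes u :: "nat \<Rightarrow> 'a::metric_space"
  assumes "convergent (\<lambda>n. dist (u n) a)"
  shows "bounded (range u)"
proof -
  have "Bseq (\<lambda>n. dist (u n) a)"
    using assms by (rule convergent_imp_Bseq)
  then obtain B where "\<And>n. dist (u n) a \<le> B"
    unfolding Bseq_def by auto
  then show ?thesis
    unfolding bounded_def by (metis (no_types, lifting) dist_commute imageE)
qed

text \<open>Both distances differ by at most \<open>dist (v n) c\<close>. This replaces a stable partner sequence by
  its limit point.\<close>

lemma convergent_dist_limit:
  fixes u v :: "nat \<Rightarrow> 'a::metric_space"
  assumes "convergent (\<lambda>n. dist (u n) (v n))" "v \<longlonglongrightarrow> c"
  shows "convergent (\<lambda>n. dist (u n) c)"
proof -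
  obtain d where d: "(\<lambda>n. dist (u n) (v n)) \<longlonglongrightarrow> d"
    using assms(1) by (auto simp: convergent_def)
  have "(\<lambda>n. dist (v n) c) \<longlonglongrightarrow> 0"
    using assms(2) by (rule tendsto_dist_iff[THEN iffD1])
  then have "(\<lambda>n. dist (u n) (v n) - dist (u n) c) \<longlonglongrightarrow> 0"
  proof (rule Lim_null_comparison[rotated])
    have "\<bar>dist (u n) (v n) - dist (u n) c\<bar> \<le> dist (v n) c" for n
      using abs_dist_diff_le[of "v n" "u n" c] by (simp add: dist_commute)
    then show "eventually (\<lambda>n. norm (dist (u n) (v n) - dist (u n) c) \<le> dist (v n) c) sequentially"
      by simp
  qed
  from tendsto_diff[OF d this] show ?thesis
    by (auto simp: convergent_def)
qed

lemma tendsto_if_subseq_tendsto_and_convergent_dist: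
  fixes u :: "nat \<Rightarrow> 'a::metric_space"
  assumes "convergent (\<lambda>n. dist (u n) c)" "strict_mono s" "(u \<circ> s) \<longlonglongrightarrow> c"
  shows "u \<longlonglongrightarrow> c"
proof -
  obtain d where d: "(\<lambda>n. dist (u n) c) \<longlonglongrightarrow> d"
    using assms(1) by (auto simp: convergent_def)
  have "(\<lambda>n. dist ((u \<circ> s) n) c) \<longlonglongrightarrow> 0"
    using assms(3) by (rule tendsto_dist_iff[THEN iffD1])
  then have "d = 0"
    using LIMSEQ_subseq_LIMSEQ[OF d assms(2)] LIMSEQ_unique by (fastforce simp: o_def)
  with d show ?thesis
    by (subst tendsto_dist_iff) simp
qed

text \<open>The ambiguity left by convergent distances to known sequences: only cluster points with the
  same distances to the known limits can coexist.\<close>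

lemma cluster_points_equidistant:
  fixes u v :: "nat \<Rightarrow> 'a::metric_space"
  assumes "convergent (\<lambda>n. dist (u n) (v n))" "v \<longlonglongrightarrow> q"
    and "strict_mono s" "(u \<circ> s) \<longlonglongrightarrow> w" "strict_mono t" "(u \<circ> t) \<longlonglongrightarrow> w'"
  shows "dist w q = dist w' q"
proof -
  obtain d where d: "(\<lambda>n. dist (u n) q) \<longlonglongrightarrow> d"
    using convergent_dist_limit[OF assms(1,2)] by (auto simp: convergent_def)
  have "dist w q = d" if "strict_mono s" "(u \<circ> s) \<longlonglongrightarrow> w" for s w
  proof (rule LIMSEQ_unique)
    show "(\<lambda>n. dist ((u \<circ> s) n) q) \<longlonglongrightarrow> dist w q"
      using that(2) tendsto_const by (rule tendsto_dist)
    show "(\<lambda>n. dist ((u \<circ> s) n) q) \<longlonglongrightarrow> d"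
      using LIMSEQ_subseq_LIMSEQ[OF d that(1)] by (simp add: o_def)
  qed
  then show ?thesis using assms(3-6) by metis
qed

section \<open>Limits of blow-ups of a starlike set\<close>

lemma closed_Con: "closed (Con a X)"
  unfolding Con_def by (rule closed_Inter) simp

lemma cone_at_Con: "cone_at a (Con a X)"
  by (simp add: Con_def cone_at_def)

lemma subset_Con: "X \<subseteq> Con a X"
  unfolding Con_def by blast

text \<open>The closure of the union of the rays is itself a closed cone, because a homothety with center
  \<open>a\<close> is continuous and maps each ray into itself.\<close>

lemma Con_subset_closure_rays:
  "Con a X \<subseteq> closure {a + t *\<^sub>R (b - a) |t b. 0 \<le> t \<and> b \<in> X}" (is "_ \<subseteq> closure ?K")
proof -
  have "cone_at a (closure ?K)"
    unfolding cone_at_def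
  proof (intro ballI allI impI)
    fix c t assume c: "c \<in> closure ?K" and t: "(0::real) \<le> t"
    let ?h = "\<lambda>c. a + of_real t * (c - a)"
    have "?h k \<in> ?K" if k: "k \<in> ?K" for k
    proof -
      obtain u b where "k = a + u *\<^sub>R (b - a)" "0 \<le> u" "b \<in> X"
        using k by blast
      then have "?h k = a + (t * u) *\<^sub>R (b - a)" "0 \<le> t * u" "b \<in> X"
        using t by (auto simp: scaleR_conv_of_real)
      then show ?thesis by blast
    qed
    then have "?h ` ?K \<subseteq> closure ?K"
      using closure_subset by blast
    then have "?h ` closure ?K \<subseteq> closure ?K"
      by (intro image_closure_subset continuous_intros) auto
    with c show "?h c \<in> closure ?K" by blast
  qed
  moreover have "b \<in> ?K" if "b \<in> X" for b
    using that by (intro CollectI exI[of _ 1] exI[of _ b]) simp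
  then have "X \<subseteq> closure ?K"
    using closure_subset by fastforce
  ultimately show ?thesis
    unfolding Con_def by (intro Inter_lower) simp
qed

text \<open>A blow-up moves each point along its ray from \<open>a\<close>, so it stays in every cone that contains \<open>X\<close>.\<close>

lemma blowup_limit_in_Con:
  assumes "\<And>n. 0 < r n" "x \<in> UNIV \<rightarrow> X" "blowup r a x \<longlonglongrightarrow> c"
  shows "c \<in> Con a X"
proof (rule closed_sequentially[OF closed_Con _ assms(3)])
  fix n
  have "a + of_real (inverse (r n)) * (x n - a) \<in> Con a X"
    using cone_at_Con[of a X] subset_Con[of X a] assms(1)[of n] assms(2)
    unfolding cone_at_def by (metis PiE UNIV_I inverse_nonnegative_iff_nonnegative less_imp_le subsetD)
  then show "blowup r a x n \<in> Con a X"
    by (simp add: blowup_def scaleR_conv_of_real)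
qed

text \<open>Starlikeness puts \<open>a + (t * r n) *\<^sub>R (b - a)\<close> into \<open>X\<close> as soon as \<open>t * r n < 1\<close>, so the point
  \<open>a + t *\<^sub>R (b - a)\<close> eventually lies in the blown-up sets \<open>Y n\<close>. For a limit \<open>c\<close> of such points
  the distance to \<open>Y n\<close> therefore tends to 0, and near-optimal points of \<open>Y n\<close> give the
  sequence.\<close>

lemma Con_point_is_blowup_limit:
  assumes "a \<in> X" "starlike_at a X" "normalizing r" "c \<in> Con a X"
  obtains x where "x \<in> UNIV \<rightarrow> X" "blowup r a x \<longlonglongrightarrow> c"
proof -
  have r: "\<And>n. 0 < r n" "r \<longlonglongrightarrow> 0"
    using assms(3) by (auto simp: normalizing_def)
  define Y where "Y n = (\<lambda>x. a + (x - a) /\<^sub>R r n) ` X" for n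
  have Y: "Y n \<noteq> {}" for n
    using assms(1) by (auto simp: Y_def)
  have ray: "eventually (\<lambda>n. a + t *\<^sub>R (b - a) \<in> Y n) sequentially" if "0 \<le> t" "b \<in> X" for t b
  proof -
    have "(\<lambda>n. t * r n) \<longlonglongrightarrow> 0"
      using tendsto_mult_right_zero[OF r(2)] by simp
    then have "eventually (\<lambda>n. t * r n < 1) sequentially"
      by (rule order_tendstoD) simp
    then show ?thesis
    proof eventually_elim
      case (elim n)
      have "a + (t * r n) *\<^sub>R (b - a) \<in> closed_segment a b"
        unfolding closed_segment_def using elim that r(1)[of n]
        by (intro CollectI exI[of _ "t * r n"]) (auto simp: algebra_simps)
      then have "a + (t * r n) *\<^sub>R (b - a) \<in> X"
        using assms(2) that by (auto simp: starlike_at_def)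
      then show ?case
        unfolding Y_def using r(1)[of n] by (rule_tac rev_image_eqI) auto
    qed
  qed
  have inf: "(\<lambda>n. infdist c (Y n)) \<longlonglongrightarrow> 0"
  proof (rule LIMSEQ_I)
    fix e :: real assume "0 < e"
    moreover have "c \<in> closure {a + t *\<^sub>R (b - a) |t b. 0 \<le> t \<and> b \<in> X}"
      using assms(4) Con_subset_closure_rays by blast
    ultimately obtain t b where tb: "0 \<le> t" "b \<in> X" "dist (a + t *\<^sub>R (b - a)) c < e"
      unfolding closure_approachable by blast
    from ray[OF tb(1,2)] obtain N where "\<And>n. n \<ge> N \<Longrightarrow> a + t *\<^sub>R (b - a) \<in> Y n"
      unfolding eventually_sequentially by blast
    then have "infdist c (Y n) < e" if "n \<ge> N" for n
      using infdist_le[of "a + t *\<^sub>R (b - a)" "Y n" c] that tb(3)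
      by (metis dist_commute order_le_less_trans)
    then show "\<exists>N. \<forall>n\<ge>N. norm (infdist c (Y n) - 0) < e"
      by (auto simp: infdist_nonneg)
  qed
  \<comment> \<open>The infimum need not be attained; the slack \<open>r n\<close> is positive and tends to 0.\<close>
  have "\<exists>x\<in>X. dist c (a + (x - a) /\<^sub>R r n) < infdist c (Y n) + r n" for n
  proof -
    have "Inf (dist c ` Y n) < infdist c (Y n) + r n"
      using r(1)[of n] Y[of n] by (simp add: infdist_def)
    then have "\<exists>d\<in>dist c ` Y n. d < infdist c (Y n) + r n"
      using Y[of n] by (intro cInf_lessD) auto
    then show ?thesis by (auto simp: Y_def)
  qed
  then obtain x where x: "\<And>n. x n \<in> X"
    "\<And>n. dist c (blowup r a x n) < infdist c (Y n) + r n"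
    unfolding blowup_def by metis
  have "(\<lambda>n. dist (blowup r a x n) c) \<longlonglongrightarrow> 0"
  proof (rule tendsto_sandwich[OF _ _ tendsto_const])
    show "(\<lambda>n. infdist c (Y n) + r n) \<longlonglongrightarrow> 0"
      using tendsto_add[OF inf r(2)] by simp
    show "eventually (\<lambda>n. dist (blowup r a x n) c \<le> infdist c (Y n) + r n) sequentially"
      using x(2) by (intro always_eventually allI) (simp add: dist_commute less_imp_le)
  qed auto
  then have "blowup r a x \<longlonglongrightarrow> c"
    by (rule tendsto_dist_iff[THEN iffD2])
  with x(1) show thesis
    by (intro that) auto
qed

section \<open>The family of sequences with convergent blow-up\<close>

text \<open>One witness \<open>x\<close> per point of the cone suffices, so this applies both to the whole convergent
  family and to the family of its subsequences. The witness for the point \<open>a\<close> keeps the blow-up of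
  \<open>z\<close> bounded; the witness for a cluster point of this blow-up forces convergence.\<close>

lemma blowup_convergent_if_stable_with_Con:
  assumes "a \<in> X" "\<And>n. 0 < r n" "z \<in> UNIV \<rightarrow> X"
    and "\<And>c. c \<in> Con a X \<Longrightarrow> \<exists>x. blowup r a x \<longlonglongrightarrow> c \<and> mutually_stable r z x"
  shows "\<exists>c\<in>Con a X. blowup r a z \<longlonglongrightarrow> c"
proof -
  have conv: "convergent (\<lambda>n. dist (blowup r a z n) c)" if "c \<in> Con a X" for c
  proof -
    obtain x where x: "blowup r a x \<longlonglongrightarrow> c" "mutually_stable r z x"
      using assms(4) \<open>c \<in> Con a X\<close> by blast
    have "convergent (\<lambda>n. dist (blowup r a z n) (blowup r a x n))"
      using x(2) mutually_stable_iff_blowup assms(2) by blast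
    then show ?thesis
      using x(1) by (rule convergent_dist_limit)
  qed
  have "bounded (range (blowup r a z))"
    using conv subset_Con assms(1) by (blast intro: bounded_if_convergent_dist)
  then obtain c s where s: "strict_mono s" "(blowup r a z \<circ> s) \<longlonglongrightarrow> c"
    using bounded_imp_convergent_subsequence by blast
  have c: "c \<in> Con a X"
  proof (rule blowup_limit_in_Con)
    show "blowup (r \<circ> s) a (z \<circ> s) \<longlonglongrightarrow> c"
      using s(2) by (simp add: blowup_subseq)
  qed (use assms(2,3) in auto)
  moreover have "blowup r a z \<longlonglongrightarrow> c"
    using conv[OF c] s by (rule tendsto_if_subseq_tendsto_and_convergent_dist)
  ultimately show ?thesis by blast
qed

lemma pretangent_family_convergent_family:
  assumes "a \<in> X" "starlike_at a X" "normalizing r"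
  shows "pretangent_family X a r (convergent_family X a r)"
proof -
  have r: "\<And>n. 0 < r n"
    using assms(3) by (auto simp: normalizing_def)
  have "self_stable r (convergent_family X a r)"
    using seq_dist_eq_dist_limits(1)[OF r]
    by (fastforce simp: self_stable_def convergent_family_def convergent_def)
  moreover have "z \<in> convergent_family X a r"
    if z: "z \<in> UNIV \<rightarrow> X" and st: "\<And>x. x \<in> convergent_family X a r \<Longrightarrow> mutually_stable r z x" for z
  proof -
    have "\<exists>c\<in>Con a X. blowup r a z \<longlonglongrightarrow> c"
    proof (rule blowup_convergent_if_stable_with_Con[OF assms(1) r z])
      fix c assume "c \<in> Con a X"
      then obtain x where x: "x \<in> UNIV \<rightarrow> X" "blowup r a x \<longlonglongrightarrow> c"
        using Con_point_is_blowup_limit assms by blast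
      then have "x \<in> convergent_family X a r"
        by (auto simp: convergent_family_def convergent_def)
      then show "\<exists>x. blowup r a x \<longlonglongrightarrow> c \<and> mutually_stable r z x"
        using st x(2) by blast
    qed
    then show ?thesis
      using z by (auto simp: convergent_family_def convergent_def)
  qed
  ultimately show ?thesis
    using assms unfolding pretangent_family_def maximal_self_stable_def
    by (auto simp: convergent_family_def convergent_const)
qed

section \<open>Isometries between pretangent spaces\<close>

lemma pretangent_space_eq_image_proj: "pretangent_space r F = pretangent_proj r F ` F"
  by (auto simp: pretangent_space_def pretangent_proj_def quotient_def)

lemma pretangent_proj_eq_iff:
  assumes "\<And>n. 0 < r n" "self_stable r F" "x \<in> F" "y \<in> F"
  shows "pretangent_proj r F x = pretangent_proj r F y \<longleftrightarrow> seq_dist r x y = 0"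
proof -
  have "pretangent_proj r F x = pretangent_proj r F y \<longleftrightarrow> (x, y) \<in> zero_dist_rel r F"
    unfolding pretangent_proj_def
    using eq_equiv_class_iff[OF equiv_zero_dist_rel[OF assms(1,2)] assms(3,4)] .
  then show ?thesis
    using assms(3,4) by (simp add: zero_dist_rel_def)
qed

text \<open>Distances are always preserved, as the limit along a subsequence is the same. What remains is
  surjectivity, expressed on representatives so that it can be checked without quotients.\<close>

lemma isometry_between_em_iff:
  assumes r: "\<And>n. 0 < r n" and F: "self_stable r F" and s: "strict_mono s"
    and F': "self_stable (r \<circ> s) F'" and sub: "(\<lambda>x. x \<circ> s) ` F \<subseteq> F'"
  shows "isometry_between (pretangent_space r F) (pretangent_dist r)
           (pretangent_space (r \<circ> s) F') (pretangent_dist (r \<circ> s)) (em r s F')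
         \<longleftrightarrow> (\<forall>z\<in>F'. \<exists>x\<in>F. seq_dist (r \<circ> s) (x \<circ> s) z = 0)"
proof -
  let ?p = "pretangent_proj r F" and ?p' = "pretangent_proj (r \<circ> s) F'"
  have rs: "\<And>n. 0 < (r \<circ> s) n" using r by simp
  have em: "em r s F' (?p x) = ?p' (x \<circ> s)" if "x \<in> F" for x
    using em_proj[OF r F s F' sub that] .
  have mem: "x \<circ> s \<in> F'" if "x \<in> F" for x
    using sub that by blast
  have "pretangent_dist (r \<circ> s) (em r s F' (?p x)) (em r s F' (?p y)) = pretangent_dist r (?p x) (?p y)"
    if "x \<in> F" "y \<in> F" for x y
    using that F seq_dist_subseq[OF _ s, of r x y]
    by (simp add: em mem pretangent_dist_proj[OF r F] pretangent_dist_proj[OF rs F'] self_stable_def)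
  moreover have "em r s F' ` ?p ` F = ?p' ` F' \<longleftrightarrow> (\<forall>z\<in>F'. \<exists>x\<in>F. seq_dist (r \<circ> s) (x \<circ> s) z = 0)"
  proof -
    have img: "em r s F' ` ?p ` F = (\<lambda>x. ?p' (x \<circ> s)) ` F"
      using em by (simp add: image_image)
    have "(\<lambda>x. ?p' (x \<circ> s)) ` F \<subseteq> ?p' ` F'"
      using mem by blast
    then have "em r s F' ` ?p ` F = ?p' ` F' \<longleftrightarrow> ?p' ` F' \<subseteq> (\<lambda>x. ?p' (x \<circ> s)) ` F"
      unfolding img by (simp add: set_eq_subset)
    also have "\<dots> \<longleftrightarrow> (\<forall>z\<in>F'. \<exists>x\<in>F. ?p' (x \<circ> s) = ?p' z)"
      unfolding image_subset_iff image_iff by (simp add: eq_commute)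
    also have "\<dots> \<longleftrightarrow> (\<forall>z\<in>F'. \<exists>x\<in>F. seq_dist (r \<circ> s) (x \<circ> s) z = 0)"
      using pretangent_proj_eq_iff[OF rs F' mem] by (intro ball_cong bex_cong) auto
    finally show ?thesis .
  qed
  ultimately show ?thesis
    unfolding isometry_between_def pretangent_space_eq_image_proj by auto
qed

lemma isometry_from_pretangent_space:
  assumes "\<And>n. 0 < r n" "self_stable r F"
    and g: "\<And>x y. x \<in> F \<Longrightarrow> y \<in> F \<Longrightarrow> dist (g x) (g y) = seq_dist r x y"
  obtains \<psi> where "isometry_between (pretangent_space r F) (pretangent_dist r) (g ` F) dist \<psi>"
    and "\<And>x. x \<in> F \<Longrightarrow> \<psi> (pretangent_proj r F x) = g x"
proof -
  define \<psi> where "\<psi> A = the_elem (g ` A)" for A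
  have \<psi>: "\<psi> (pretangent_proj r F x) = g x" if "x \<in> F" for x
    unfolding \<psi>_def
  proof (rule the_elem_image)
    show "x \<in> pretangent_proj r F x"
      using that by (simp add: pretangent_proj_def zero_dist_rel_def)
    fix y assume "y \<in> pretangent_proj r F x"
    then have "y \<in> F" "seq_dist r x y = 0"
      by (auto simp: pretangent_proj_def zero_dist_rel_def)
    then show "g y = g x"
      using g[OF that] by fastforce
  qed
  have "isometry_between (pretangent_space r F) (pretangent_dist r) (g ` F) dist \<psi>"
    unfolding isometry_between_def pretangent_space_eq_image_proj
    using assms by (simp add: image_image \<psi> pretangent_dist_proj)
  with \<psi> show thesis by (intro that)
qed

section \<open>Tangency of the convergent family\<close>

text \<open>An element \<open>z\<close> of a maximal family along a subsequence is stable with the restrictions of the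
  convergent family, whose limits still fill \<open>Con a X\<close>. So its blow-up converges to a point that
  is also the limit of one of these restrictions, and the two are at distance 0.\<close>

lemma tangent_convergent_family:
  assumes "a \<in> X" "starlike_at a X" "normalizing r"
  shows "tangent X a r (convergent_family X a r)"
  unfolding tangent_def
proof (intro conjI allI impI)
  let ?F = "convergent_family X a r"
  show pre: "pretangent_family X a r ?F"
    using pretangent_family_convergent_family assms .
  have r: "\<And>n. 0 < r n"
    using assms(3) by (auto simp: normalizing_def)
  have F: "self_stable r ?F"
    using pre by (auto simp: pretangent_family_def maximal_self_stable_def)
  fix s F'
  assume s: "strict_mono s" and max: "maximal_self_stable X (r \<circ> s) F'"
    and sub: "(\<lambda>x. x \<circ> s) ` ?F \<subseteq> F'"
  have rs: "\<And>n. 0 < (r \<circ> s) n" using r by simp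
  have F': "self_stable (r \<circ> s) F'" "F' \<subseteq> UNIV \<rightarrow> X"
    using max by (auto simp: maximal_self_stable_def)
  have lift: "\<exists>x\<in>?F. blowup (r \<circ> s) a (x \<circ> s) \<longlonglongrightarrow> c" if c: "c \<in> Con a X" for c
  proof -
    obtain x where x: "x \<in> UNIV \<rightarrow> X" "blowup r a x \<longlonglongrightarrow> c"
      using Con_point_is_blowup_limit assms c by blast
    then show ?thesis
      using LIMSEQ_subseq_LIMSEQ[OF x(2) s]
      by (intro bexI[of _ x]) (auto simp: blowup_subseq convergent_family_def convergent_def)
  qed
  have "\<exists>x\<in>?F. seq_dist (r \<circ> s) (x \<circ> s) z = 0" if z: "z \<in> F'" for z
  proof -
    have "\<exists>c\<in>Con a X. blowup (r \<circ> s) a z \<longlonglongrightarrow> c"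
    proof (rule blowup_convergent_if_stable_with_Con[OF assms(1) rs])
      show "z \<in> UNIV \<rightarrow> X" using z F'(2) by blast
      fix c assume "c \<in> Con a X"
      then obtain x where "x \<in> ?F" "blowup (r \<circ> s) a (x \<circ> s) \<longlonglongrightarrow> c"
        using lift by blast
      moreover from this have "mutually_stable (r \<circ> s) z (x \<circ> s)"
        using z sub F'(1) unfolding self_stable_def by blast
      ultimately show "\<exists>x. blowup (r \<circ> s) a x \<longlonglongrightarrow> c \<and> mutually_stable (r \<circ> s) z x"
        by blast
    qed
    then obtain c where c: "c \<in> Con a X" "blowup (r \<circ> s) a z \<longlonglongrightarrow> c" by blast
    then obtain x where x: "x \<in> ?F" "blowup (r \<circ> s) a (x \<circ> s) \<longlonglongrightarrow> c"
      using lift by blast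
    have "seq_dist (r \<circ> s) (x \<circ> s) z = 0"
      using seq_dist_eq_dist_limits(2)[OF rs x(2) c(2)] by simp
    with x(1) show ?thesis by blast
  qed
  then show "isometry_between (pretangent_space r ?F) (pretangent_dist r)
          (pretangent_space (r \<circ> s) F') (pretangent_dist (r \<circ> s)) (em r s F')"
    using isometry_between_em_iff[OF r F s F'(1) sub] by blast
qed

section \<open>A subsequence along which all blow-ups converge\<close>

lemma bounded_nonconvergent_two_cluster_points:
  fixes u :: "nat \<Rightarrow> complex"
  assumes "bounded (range u)" "\<not> convergent u"
  obtains s t p q where "strict_mono s" "strict_mono t" "(u \<circ> s) \<longlonglongrightarrow> p" "(u \<circ> t) \<longlonglongrightarrow> q" "p \<noteq> q"
proof -
  obtain p s where s: "strict_mono s" "(u \<circ> s) \<longlonglongrightarrow> p"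
    using bounded_imp_convergent_subsequence[OF assms(1)] by blast
  have "\<not> u \<longlonglongrightarrow> p"
    using assms(2) by (auto simp: convergent_def)
  then obtain e where e: "e > 0" "\<And>N. \<exists>n\<ge>N. dist (u n) p \<ge> e"
    unfolding lim_sequentially by (meson not_less)
  then have "infinite {n. dist (u n) p \<ge> e}"
    unfolding infinite_nat_iff_unbounded_le by blast
  then obtain t0 :: "nat \<Rightarrow> nat" where t0: "strict_mono t0" "\<And>n. dist (u (t0 n)) p \<ge> e"
    using infinite_enumerate by blast
  have "bounded (range (u \<circ> t0))"
    using assms(1) by (rule bounded_subset) auto
  then obtain q t1 where t1: "strict_mono t1" "((u \<circ> t0) \<circ> t1) \<longlonglongrightarrow> q"
    using bounded_imp_convergent_subsequence by blast
  have "(\<lambda>n. dist (((u \<circ> t0) \<circ> t1) n) p) \<longlonglongrightarrow> dist q p"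
    by (intro tendsto_intros t1)
  then have "e \<le> dist q p"
    by (rule LIMSEQ_le_const) (use t0 in auto)
  with e(1) have "p \<noteq> q" by auto
  then show thesis
    using that[of s "t0 \<circ> t1" p q] s t0(1) t1
    by (auto simp: strict_mono_o o_assoc)
qed

text \<open>The perpendicular bisector of \<open>v\<close> and \<open>w\<close>, described from one of its points \<open>a\<close>.\<close>

lemma equidistant_iff_inner:
  fixes a p v w :: complex
  assumes "dist v a = dist w a"
  shows "dist v p = dist w p \<longleftrightarrow> (v - w) \<bullet> (p - a) = 0"
proof -
  have sq: "dist v p = dist w p \<longleftrightarrow> (dist v p)\<^sup>2 = (dist w p)\<^sup>2" for p
    by simp
  have "(dist v p)\<^sup>2 - (dist w p)\<^sup>2 = (dist v a)\<^sup>2 - (dist w a)\<^sup>2 - 2 * ((v - w) \<bullet> (p - a))" for p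
    by (simp add: dist_norm power2_norm_eq_inner algebra_simps inner_commute)
  then show ?thesis
    using assms sq by (metis diff_0 eq_iff_diff_eq_0 mult_eq_0_iff neg_equal_0_iff_equal zero_neq_numeral)
qed

text \<open>The hypotheses on \<open>q\<close> and \<open>q'\<close> say that \<open>a\<close>, \<open>p\<close>, \<open>q\<close> are not collinear: were \<open>q\<close> on the line
  through \<open>a\<close> and \<open>p\<close>, its distances to \<open>a\<close> and \<open>p\<close> would determine it. In this form the
  hypothesis is what the failure of convergence delivers.\<close>

lemma equidistant_from_three_points:
  fixes a p q q' v w :: complex
  assumes q: "q \<noteq> q'" "dist q a = dist q' a" "dist q p = dist q' p" and "p \<noteq> a"
    and vw: "dist v a = dist w a" "dist v p = dist w p" "dist v q = dist w q"
  shows "v = w"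
proof (rule ccontr)
  assume "v \<noteq> w"
  have 1: "(q - q') \<bullet> (p - a) = 0"
    using equidistant_iff_inner[OF q(2)] q(3) by blast
  have 2: "(v - w) \<bullet> (p - a) = 0" "(v - w) \<bullet> (q - a) = 0"
    using equidistant_iff_inner[OF vw(1)] vw(2,3) by blast+
  \<comment> \<open>Both \<open>v - w\<close> and \<open>q - q'\<close> are orthogonal to \<open>p - a\<close>, hence parallel in the plane; so
    \<open>q - q'\<close> is orthogonal to \<open>q - a\<close> as well, which puts \<open>q\<close> on its own bisector with \<open>q'\<close>.\<close>
  define d where "d = v - w"
  define e where "e = q - q'"
  define m where "m = p - a"
  have "Re d * Re m + Im d * Im m = 0" "Re e * Re m + Im e * Im m = 0" "m \<noteq> 0" "d \<noteq> 0"
    using 1 2 \<open>p \<noteq> a\<close> \<open>v \<noteq> w\<close> by (auto simp: d_def e_def m_def inner_complex_def)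
  then have par: "Re d * Im e = Im d * Re e"
    by (simp add: complex_eq_iff) algebra
  have "Re d * Re (q - a) + Im d * Im (q - a) = 0"
    using 2 by (simp add: d_def inner_complex_def)
  with par \<open>d \<noteq> 0\<close> have "Re e * Re (q - a) + Im e * Im (q - a) = 0"
    by (simp add: complex_eq_iff) algebra
  then have "(q - q') \<bullet> (q - a) = 0"
    by (simp add: e_def inner_complex_def)
  then have "dist q q = dist q' q"
    using equidistant_iff_inner[OF q(2)] by blast
  with q(1) show False by simp
qed

text \<open>Unless all sequences converge to \<open>a\<close>, at most two choices fix the moving frame. The first makes one sequence converge to
  a point \<open>p\<close> other than \<open>a\<close>; this removes all rotations. If some sequence \<open>y\<close> still has two cluster
  points, they are mirror images in the line through \<open>a\<close> and \<open>p\<close>, and selecting one of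
  them removes the remaining reflection.\<close>

lemma common_convergent_subsequence:
  fixes U :: "(nat \<Rightarrow> complex) set" and a :: complex
  assumes a: "(\<lambda>n. a) \<in> U"
    and conv: "\<And>u v. u \<in> U \<Longrightarrow> v \<in> U \<Longrightarrow> convergent (\<lambda>n. dist (u n) (v n))"
  shows "\<exists>s. strict_mono s \<and> (\<forall>u\<in>U. convergent (u \<circ> s))"
proof (cases "\<forall>u\<in>U. u \<longlonglongrightarrow> a")
  case True
  then show ?thesis
    by (intro exI[of _ id]) (auto simp: convergent_def strict_mono_id)
next
  case False
  then obtain x where x: "x \<in> U" "\<not> x \<longlonglongrightarrow> a" by blast
  have conv': "convergent (\<lambda>n. dist ((u \<circ> s) n) ((v \<circ> s) n))"
    if "u \<in> U" "v \<in> U" "strict_mono s" for u v s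
    using convergent_subseq_convergent[OF conv[OF that(1,2)] that(3)] by (simp add: o_def)
  have bdd: "bounded (range (u \<circ> s))" if "u \<in> U" for u and s :: "nat \<Rightarrow> nat"
    using bounded_if_convergent_dist[OF conv[OF that a]] by (rule bounded_subset) auto
  obtain p s where s: "strict_mono s" "(x \<circ> s) \<longlonglongrightarrow> p"
    using bounded_imp_convergent_subsequence[OF bdd[OF x(1), of id]] by auto
  have "p \<noteq> a"
    using tendsto_if_subseq_tendsto_and_convergent_dist[OF conv[OF x(1) a] s(1)] s(2) x(2) by blast
  show ?thesis
  proof (cases "\<forall>u\<in>U. convergent (u \<circ> s)")
    case True
    with s(1) show ?thesis by blast
  next
    case False
    then obtain y where y: "y \<in> U" "\<not> convergent (y \<circ> s)" by blast
    obtain t t' q q' where t: "strict_mono t" "strict_mono t'"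
      "(y \<circ> s \<circ> t) \<longlonglongrightarrow> q" "(y \<circ> s \<circ> t') \<longlonglongrightarrow> q'" "q \<noteq> q'"
      using bounded_nonconvergent_two_cluster_points[OF bdd[OF y(1)] y(2)] by metis
    have as: "((\<lambda>n. a) \<circ> s) \<longlonglongrightarrow> a" for s :: "nat \<Rightarrow> nat"
      by (simp add: o_def)
    have qa: "dist q a = dist q' a"
      by (rule cluster_points_equidistant[OF conv'[OF y(1) a s(1)] as t(1,3,2,4)])
    have qp: "dist q p = dist q' p"
      by (rule cluster_points_equidistant[OF conv'[OF y(1) x(1) s(1)] s(2) t(1,3,2,4)])
    define k where "k = s \<circ> t"
    have k: "strict_mono k" "(y \<circ> k) \<longlonglongrightarrow> q" "(x \<circ> k) \<longlonglongrightarrow> p"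
      using s t LIMSEQ_subseq_LIMSEQ[OF s(2) t(1)] by (auto simp: k_def strict_mono_o o_assoc)
    have "convergent (u \<circ> k)" if u: "u \<in> U" for u
    proof (rule ccontr)
      assume "\<not> convergent (u \<circ> k)"
      then obtain l l' w w' where l: "strict_mono l" "strict_mono l'"
        "(u \<circ> k \<circ> l) \<longlonglongrightarrow> w" "(u \<circ> k \<circ> l') \<longlonglongrightarrow> w'" "w \<noteq> w'"
        using bounded_nonconvergent_two_cluster_points[OF bdd[OF u]] by metis
      note eq = cluster_points_equidistant[OF conv'[OF u _ k(1)] _ l(1,3,2,4)]
      have "w = w'"
        using eq[OF a as] eq[OF x(1) k(3)] eq[OF y(1) k(2)]
        by (rule equidistant_from_three_points[OF t(5) qa qp \<open>p \<noteq> a\<close>])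
      with l(5) show False ..
    qed
    with k(1) show ?thesis by blast
  qed
qed

lemma pretangent_family_subseq_convergent:
  assumes "pretangent_family X a r F"
  obtains s where "strict_mono s" "(\<lambda>x. x \<circ> s) ` F \<subseteq> convergent_family X a (r \<circ> s)"
proof -
  have r: "\<And>n. 0 < r n" and st: "self_stable r F" and a: "(\<lambda>n. a) \<in> F" and FX: "F \<subseteq> UNIV \<rightarrow> X"
    using assms by (auto simp: pretangent_family_def maximal_self_stable_def normalizing_def)
  have "\<exists>s. strict_mono s \<and> (\<forall>u\<in>blowup r a ` F. convergent (u \<circ> s))"
  proof (rule common_convergent_subsequence[where a = a])
    show "(\<lambda>n. a) \<in> blowup r a ` F"
      using a by (intro image_eqI[of _ _ "\<lambda>n. a"]) auto
    show "convergent (\<lambda>n. dist (u n) (v n))" if "u \<in> blowup r a ` F" "v \<in> blowup r a ` F" for u v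
      using that st mutually_stable_iff_blowup[of r] r by (auto simp: self_stable_def)
  qed
  then obtain s where s: "strict_mono s" "\<And>x. x \<in> F \<Longrightarrow> convergent (blowup r a x \<circ> s)"
    by blast
  then have "(\<lambda>x. x \<circ> s) ` F \<subseteq> convergent_family X a (r \<circ> s)"
    using FX by (fastforce simp: convergent_family_def blowup_subseq)
  with s(1) show thesis by (rule that)
qed

section \<open>Tangent spaces of starlike sets\<close>

text \<open>The map \<open>g\<close> takes limits along the subsequence \<open>s\<close>. It preserves distances for any pretangent
  space; tangency enters only to make it onto, by representing each member of the convergent family
  along \<open>s\<close> by a restriction of a member of \<open>F\<close>.\<close>

lemma tangent_space_isometric_to_Con:
  assumes "a \<in> X" "starlike_at a X" "tangent X a r F"
  shows "\<exists>\<psi>. isometry_between (pretangent_space r F) (pretangent_dist r) (Con a X) dist \<psi> \<and>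
           \<psi> (pretangent_proj r F (\<lambda>n. a)) = a"
proof -
  have pre: "pretangent_family X a r F"
    using assms(3) by (simp add: tangent_def)
  then have norm: "normalizing r" and st: "self_stable r F" and a: "(\<lambda>n. a) \<in> F"
    by (auto simp: pretangent_family_def maximal_self_stable_def)
  then have r: "\<And>n. 0 < r n" by (auto simp: normalizing_def)
  obtain s where s: "strict_mono s" "(\<lambda>x. x \<circ> s) ` F \<subseteq> convergent_family X a (r \<circ> s)"
    using pretangent_family_subseq_convergent[OF pre] .
  let ?G = "convergent_family X a (r \<circ> s)"
  have rs: "\<And>n. 0 < (r \<circ> s) n" using r by simp
  have norm': "normalizing (r \<circ> s)"
    using normalizing_subseq norm s(1) .
  have G: "maximal_self_stable X (r \<circ> s) ?G"
    using pretangent_family_convergent_family[OF assms(1,2) norm']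
    by (simp add: pretangent_family_def)
  then have Gst: "self_stable (r \<circ> s) ?G"
    by (simp add: maximal_self_stable_def)
  have "isometry_between (pretangent_space r F) (pretangent_dist r)
          (pretangent_space (r \<circ> s) ?G) (pretangent_dist (r \<circ> s)) (em r s ?G)"
    using assms(3) G s by (simp add: tangent_def)
  then have surj: "\<exists>x\<in>F. seq_dist (r \<circ> s) (x \<circ> s) z = 0" if "z \<in> ?G" for z
    using isometry_between_em_iff[OF r st s(1) Gst s(2)] that by blast
  define g where "g x = lim (blowup (r \<circ> s) a (x \<circ> s))" for x
  have g: "blowup (r \<circ> s) a (x \<circ> s) \<longlonglongrightarrow> g x" if "x \<in> F" for x
    using s(2) that by (auto simp: g_def convergent_family_def convergent_LIMSEQ_iff)
  have "dist (g x) (g y) = seq_dist r x y" if "x \<in> F" "y \<in> F" for x y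
    using seq_dist_eq_dist_limits(2)[OF rs g[OF that(1)] g[OF that(2)]]
      seq_dist_subseq[OF _ s(1), of r x y] st that
    by (simp add: self_stable_def)
  then obtain \<psi> where \<psi>: "isometry_between (pretangent_space r F) (pretangent_dist r) (g ` F) dist \<psi>"
    "\<And>x. x \<in> F \<Longrightarrow> \<psi> (pretangent_proj r F x) = g x"
    using isometry_from_pretangent_space[OF r st] by blast
  have "g ` F = Con a X"
  proof
    show "g ` F \<subseteq> Con a X"
    proof (rule image_subsetI)
      fix x assume x: "x \<in> F"
      then have "x \<circ> s \<in> UNIV \<rightarrow> X"
        using s(2) by (auto simp: convergent_family_def)
      then show "g x \<in> Con a X"
        by (rule blowup_limit_in_Con[OF rs _ g[OF x]])
    qed
    show "Con a X \<subseteq> g ` F"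
    proof
      fix c assume "c \<in> Con a X"
      then obtain z where z: "z \<in> UNIV \<rightarrow> X" "blowup (r \<circ> s) a z \<longlonglongrightarrow> c"
        using Con_point_is_blowup_limit[OF assms(1,2) norm'] by blast
      then have "z \<in> ?G"
        by (auto simp: convergent_family_def convergent_def)
      then obtain x where x: "x \<in> F" "seq_dist (r \<circ> s) (x \<circ> s) z = 0"
        using surj by blast
      then have "dist (g x) c = 0"
        using seq_dist_eq_dist_limits(2)[OF rs g z(2)] by simp
      with x(1) show "c \<in> g ` F" by auto
    qed
  qed
  moreover have "g (\<lambda>n. a) = a"
    by (simp add: g_def o_def limI)
  ultimately show ?thesis
    using \<psi> a by metis
qed

lemma pretangent_space_lies_in_tangent:
  assumes "a \<in> X" "starlike_at a X" "pretangent_family X a r F"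
  shows "lies_in_tangent X a r F"
proof -
  obtain s where s: "strict_mono s" "(\<lambda>x. x \<circ> s) ` F \<subseteq> convergent_family X a (r \<circ> s)"
    using pretangent_family_subseq_convergent[OF assms(3)] .
  have "normalizing (r \<circ> s)"
    using normalizing_subseq assms(3) s(1) by (auto simp: pretangent_family_def)
  then have "tangent X a (r \<circ> s) (convergent_family X a (r \<circ> s))"
    by (rule tangent_convergent_family[OF assms(1,2)])
  then show ?thesis
    using s unfolding lies_in_tangent_def tangent_def pretangent_family_def by blast
qed

theorem theorem1p7:
  fixes X :: "complex set" and a :: complex
  assumes "a \<in> X" and "starlike_at a X"
  shows "(\<forall>r F. tangent X a r F \<longrightarrow>
            (\<exists>\<psi>. isometry_between (pretangent_space r F) (pretangent_dist r) (Con a X) dist \<psi> \<and>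
                 \<psi> (pretangent_proj r F (\<lambda>n. a)) = a)) \<and>
         (\<forall>r F. pretangent_family X a r F \<longrightarrow> lies_in_tangent X a r F)"
  using tangent_space_isometric_to_Con[OF assms] pretangent_space_lies_in_tangent[OF assms]
  by blast

end
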